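(* For any real number $\alpha\ge1$, there is no non-constant $\varphi\in H^\infty_1(\mathbb{D})$ such that the de Branges-Rovnyak space $\mathcal{H}(B_\alpha^\varphi)$ of the weighted Bergman space $\mathcal{H}(B_\alpha)$ is a CNP space, where $B_\alpha(z,w)=\frac{1}{(1-z\overline{w})^{2+\alpha}}$ $(z,w\in\mathbb{D})$.
   Context: $\mathbb{D}$ is the open unit disc in $\mathbb{C}$. $H^\infty_1(\mathbb{D})$ is the set of holomorphic functions $\varphi:\mathbb{D}\to\mathbb{C}$ with $\sup|\varphi|\le1$. The power $(1-z\overline w)^{2+\alpha}$ is taken with the principal branch. For a kernel (positive semi-definite function) $K$, $\mathcal{H}(K)$ denotes the associated reproducing kernel Hilbert space. The space $\mathcal{H}(B_\alpha^\varphi)$ is the reproducing kernel Hilbert space on $\mathbb{D}$ with kernel $B_\alpha^\varphi(z,w)=(1-\varphi(z)\overline{\varphi(w)})B_\alpha(z,w)$. A kernel $K$ on a set $\Omega$ is a complete Nevanlinna-Pick (CNP) kernel, and $\mathcal{H}(K)$ a CNP space, if for all $m,n\in\mathbb{N}$, every finite set of distinct points $x_1,\dots,x_k\in\Omega$ and all complex $m\times n$ matrices $W_1,\dots,W_k$ for which the block matrix $[(I-W_iW_j^* )K(x_i,x_j)]_{i,j=1}^k$ is positive semi-definite, there is a function $\Phi$ from $\Omega$ to the $m\times n$ matrices, multiplying $\mathcal{H}(K)\otimes\mathbb{C}^n$ into $\mathcal{H}(K)\otimes\mathbb{C}^m$, with $\Phi(x_i)=W_i$ for all $i$ and multiplication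 operator satisfying $\|M_\Phi\|\le1$. *)

theory Defs
  imports
    "HOL-Complex_Analysis.Complex_Analysis"
    "Jordan_Normal_Form.Schur_Decomposition"
begin

definition pos_semidef :: "'i set \<Rightarrow> ('i \<Rightarrow> 'i \<Rightarrow> complex) \<Rightarrow> bool" where
  "pos_semidef I A \<longleftrightarrow>
     (\<forall>c. (\<Sum>i\<in>I. \<Sum>j\<in>I. cnj (c i) * A i j * c j) \<in> \<real>\<^sub>\<ge>\<^sub>0)"

definition psd_kernel :: "'a set \<Rightarrow> ('a \<Rightarrow> 'a \<Rightarrow> complex) \<Rightarrow> bool" where
  "psd_kernel \<Omega> K \<longleftrightarrow> (\<forall>X. finite X \<longrightarrow> X \<subseteq> \<Omega> \<longrightarrow> pos_semidef X K)"

definition restrict0 :: "'a set \<Rightarrow> ('a \<Rightarrow> complex) \<Rightarrow> 'a \<Rightarrow> complex" where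
  "restrict0 \<Omega> f = (\<lambda>x. if x \<in> \<Omega> then f x else 0)"

definition sqnorm ::
  "(('a \<Rightarrow> complex) \<Rightarrow> ('a \<Rightarrow> complex) \<Rightarrow> complex) \<Rightarrow> ('a \<Rightarrow> complex) \<Rightarrow> real"
where
  "sqnorm ip f = Re (ip f f)"

text \<open>
  A complex Hilbert space of functions on \<open>\<Omega>\<close> with reproducing kernel \<open>K\<close>: \<open>H\<close> is the set of
  its elements, \<open>ip\<close> its inner product (linear in the first argument). A function on \<open>\<Omega>\<close> is
  represented by its extension by zero. By the Moore-Aronszajn theorem, for every positive
  semi-definite \<open>K\<close> there is such a space, and \<open>\<Omega>\<close> and \<open>K\<close> determine \<open>H\<close> and the values of
  \<open>ip\<close> on \<open>H\<close>.
\<close>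

locale rkhs =
  fixes \<Omega> :: "'a set"
    and K :: "'a \<Rightarrow> 'a \<Rightarrow> complex"
    and H :: "('a \<Rightarrow> complex) set"
    and ip :: "('a \<Rightarrow> complex) \<Rightarrow> ('a \<Rightarrow> complex) \<Rightarrow> complex"
  assumes zero_outside: "f \<in> H \<Longrightarrow> x \<notin> \<Omega> \<Longrightarrow> f x = 0"
    and zero_mem: "(\<lambda>x. 0) \<in> H"
    and add_mem: "f \<in> H \<Longrightarrow> g \<in> H \<Longrightarrow> (\<lambda>x. f x + g x) \<in> H"
    and scale_mem: "f \<in> H \<Longrightarrow> (\<lambda>x. c * f x) \<in> H"
    and ip_add: "f \<in> H \<Longrightarrow> g \<in> H \<Longrightarrow> h \<in> H \<Longrightarrow> ip (\<lambda>x. f x + g x) h = ip f h + ip g h"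
    and ip_scale: "f \<in> H \<Longrightarrow> h \<in> H \<Longrightarrow> ip (\<lambda>x. c * f x) h = c * ip f h"
    and ip_cnj: "f \<in> H \<Longrightarrow> g \<in> H \<Longrightarrow> ip f g = cnj (ip g f)"
    and ip_nonneg: "f \<in> H \<Longrightarrow> ip f f \<in> \<real>\<^sub>\<ge>\<^sub>0"
    and ip_definite: "f \<in> H \<Longrightarrow> ip f f = 0 \<Longrightarrow> f = (\<lambda>x. 0)"
    and complete: "(\<And>k. s k \<in> H) \<Longrightarrow>
                     (\<And>e. e > 0 \<Longrightarrow> \<exists>N. \<forall>k\<ge>N. \<forall>l\<ge>N. sqnorm ip (\<lambda>x. s k x - s l x) < e) \<Longrightarrow>
                     \<exists>f\<in>H. (\<lambda>k. sqnorm ip (\<lambda>x. s k x - f x)) \<longlonglongrightarrow> 0"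
    and kernel_mem: "w \<in> \<Omega> \<Longrightarrow> restrict0 \<Omega> (\<lambda>z. K z w) \<in> H"
    and reproducing: "f \<in> H \<Longrightarrow> w \<in> \<Omega> \<Longrightarrow> ip f (restrict0 \<Omega> (\<lambda>z. K z w)) = f w"

text \<open>
  An element of \<open>H \<otimes> \<complex>\<^sup>n\<close> is a tuple \<open>F 0, \<dots>, F (n - 1)\<close> of elements of \<open>H\<close>, with squared norm
  the sum of the squared norms of the components; values \<open>F b\<close> with \<open>b \<ge> n\<close> play no role.
\<close>

definition mult_op ::
  "'a set \<Rightarrow> nat \<Rightarrow> ('a \<Rightarrow> complex Matrix.mat) \<Rightarrow> (nat \<Rightarrow> 'a \<Rightarrow> complex) \<Rightarrow> nat \<Rightarrow> 'a \<Rightarrow> complex"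
where
  "mult_op \<Omega> n \<Phi> F a = restrict0 \<Omega> (\<lambda>x. \<Sum>b<n. \<Phi> x $$ (a, b) * F b x)"

definition contractive_multiplier ::
  "'a set \<Rightarrow> ('a \<Rightarrow> complex) set \<Rightarrow> (('a \<Rightarrow> complex) \<Rightarrow> ('a \<Rightarrow> complex) \<Rightarrow> complex)
     \<Rightarrow> nat \<Rightarrow> nat \<Rightarrow> ('a \<Rightarrow> complex Matrix.mat) \<Rightarrow> bool"
where
  "contractive_multiplier \<Omega> H ip m n \<Phi> \<longleftrightarrow>
     (\<forall>x\<in>\<Omega>. \<Phi> x \<in> carrier_mat m n) \<and>
     (\<forall>F. (\<forall>b<n. F b \<in> H) \<longrightarrow>
        (\<forall>a<m. mult_op \<Omega> n \<Phi> F a \<in> H) \<and>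
        (\<Sum>a<m. sqnorm ip (mult_op \<Omega> n \<Phi> F a)) \<le> (\<Sum>b<n. sqnorm ip (F b)))"

text \<open>
  The finite set of distinct nodes is \<open>X\<close> and the target at \<open>x \<in> X\<close> is \<open>W x\<close>; the block matrix is
  indexed by pairs of a node and a row number.
\<close>

definition matrix_NP_property ::
  "'a set \<Rightarrow> ('a \<Rightarrow> 'a \<Rightarrow> complex) \<Rightarrow> ('a \<Rightarrow> complex) set
     \<Rightarrow> (('a \<Rightarrow> complex) \<Rightarrow> ('a \<Rightarrow> complex) \<Rightarrow> complex) \<Rightarrow> bool"
where
  "matrix_NP_property \<Omega> K H ip \<longleftrightarrow>
     (\<forall>m\<ge>1. \<forall>n\<ge>1. \<forall>X W. finite X \<longrightarrow> X \<subseteq> \<Omega> \<longrightarrow> (\<forall>x\<in>X. W x \<in> carrier_mat m n) \<longrightarrow>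
        pos_semidef (X \<times> {..<m})
          (\<lambda>(x, a) (y, b). (1\<^sub>m m - W x * mat_adjoint (W y)) $$ (a, b) * K x y) \<longrightarrow>
        (\<exists>\<Phi>. contractive_multiplier \<Omega> H ip m n \<Phi> \<and> (\<forall>x\<in>X. \<Phi> x = W x)))"

text \<open>
  The existential quantifier only names the unique space \<open>H(K)\<close>.
\<close>

definition CNP_kernel :: "'a set \<Rightarrow> ('a \<Rightarrow> 'a \<Rightarrow> complex) \<Rightarrow> bool" where
  "CNP_kernel \<Omega> K \<longleftrightarrow>
     psd_kernel \<Omega> K \<and> (\<exists>H ip. rkhs \<Omega> K H ip \<and> matrix_NP_property \<Omega> K H ip)"

abbreviation unit_disc :: "complex set" ("\<bbbD>") where
  "\<bbbD> \<equiv> ball 0 1"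

definition Hinf1 :: "(complex \<Rightarrow> complex) set" where
  "Hinf1 = {\<phi>. \<phi> holomorphic_on \<bbbD> \<and> (\<forall>z\<in>\<bbbD>. cmod (\<phi> z) \<le> 1)}"

definition bergman_kernel :: "real \<Rightarrow> complex \<Rightarrow> complex \<Rightarrow> complex" where
  "bergman_kernel \<alpha> z w = 1 / (1 - z * cnj w) powr complex_of_real (2 + \<alpha>)"

definition sub_bergman_kernel :: "real \<Rightarrow> (complex \<Rightarrow> complex) \<Rightarrow> complex \<Rightarrow> complex \<Rightarrow> complex" where
  "sub_bergman_kernel \<alpha> \<phi> z w = (1 - \<phi> z * cnj (\<phi> w)) * bergman_kernel \<alpha> z w"

end

theory Submission
  imports Defs "HOL-Real_Asymp.Real_Asymp"
begin

text \<open>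
  Write \<open>\<beta> = 2 + \<alpha> \<ge> 3\<close> and let \<open>K\<close> be the kernel of the de Branges-Rovnyak space. Multipliers of
  \<open>H(K)\<close> also act on the subspace of functions vanishing at a point \<open>l\<close>, whose kernel is
  \<open>K z w - K z l K l w / K l l\<close>. Interpolating the two-point data \<open>W x = 0\<close>, \<open>W y = s\<close> with \<open>s\<close>
  maximal, so that the Pick matrix is the rank one matrix \<open>K z x K x w / K x x\<close>, one obtains the
  instance of the McCullough-Quiggin condition that is needed: the matrix
  \<open>1 - K z l K l w / (K l l K z w)\<close> on \<open>{x, y}\<close> is positive semi-definite. For \<open>l = 0\<close> its entries
  are \<open>1 - (1 - z cnj w)\<^sup>\<beta> / (1 - \<psi> z cnj (\<psi> w))\<close>, where \<open>\<psi>\<close> is \<open>\<phi>\<close> followed by the disc automorphism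
  taking \<open>\<phi> 0\<close> to \<open>0\<close>. Summing over \<open>z, w \<in> {h, -h}\<close> isolates, to leading order, the coefficient of
  \<open>z\<^sup>2 cnj w\<^sup>2\<close>. With \<open>\<psi> z = c z + d z\<^sup>2 + \<dots>\<close> this coefficient is
  \<open>- \<beta> (\<beta> - 1) / 2 + \<beta> \<bar>c\<bar>\<^sup>2 - \<bar>c\<bar>\<^sup>4 - \<bar>d\<bar>\<^sup>2\<close>; since \<open>\<bar>c\<bar> \<le> 1\<close> it is at most \<open>- (\<beta> - 1) (\<beta> - 2) / 2 < 0\<close>.
\<close>

section \<open>Hilbert space geometry of a reproducing kernel space and its multipliers\<close>

context rkhs
begin

lemma ip_add_right:
  assumes "f \<in> H" "g \<in> H" "h \<in> H"
  shows "ip h (\<lambda>x. f x + g x) = ip h f + ip h g"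
  using assms ip_cnj[of h "\<lambda>x. f x + g x"] ip_cnj[of h f] ip_cnj[of h g] by (simp add: ip_add add_mem)

lemma ip_scale_right:
  assumes "f \<in> H" "h \<in> H"
  shows "ip h (\<lambda>x. c * f x) = cnj c * ip h f"
  using assms ip_cnj[of h "\<lambda>x. c * f x"] ip_cnj[of h f] by (simp add: ip_scale scale_mem)

lemma ip_zero_right:
  assumes "h \<in> H"
  shows "ip h (\<lambda>x. 0) = 0"
  using ip_scale_right[OF zero_mem assms, of 0] by simp

lemma ip_self:
  assumes "f \<in> H"
  shows "ip f f = complex_of_real (sqnorm ip f)" and "sqnorm ip f \<ge> 0"
  using ip_nonneg[OF assms] by (auto simp: sqnorm_def nonneg_Reals_def elim!: Reals_cases)

lemma Cauchy_Schwarz: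
  assumes f: "f \<in> H" and g: "g \<in> H"
  shows "(cmod (ip f g))\<^sup>2 \<le> sqnorm ip f * sqnorm ip g"
proof (cases "sqnorm ip g = 0")
  case True
  then have "g = (\<lambda>x. 0)" using ip_definite[OF g] ip_self(1)[OF g] by simp
  then show ?thesis using True ip_zero_right[OF f] by simp
next
  case False
  define a where "a = sqnorm ip g"
  define b where "b = ip f g"
  \<comment> \<open>\<open>w\<close> is \<open>a\<close> times the component of \<open>f\<close>
    orthogonal to \<open>g\<close>. The scaling avoids division, and \<open>ip w w \<ge> 0\<close>
    is then the inequality multiplied by \<open>a\<close>.\<close>
  define w where "w = (\<lambda>x. of_real a * f x + (- b) * g x)"
  have a: "a > 0" using False ip_self(2)[OF g] a_def by simp
  have w: "w \<in> H" unfolding w_def by (intro add_mem scale_mem f g)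
  have left: "ip w h = of_real a * ip f h - b * ip g h" if "h \<in> H" for h
    unfolding w_def
    by (simp only: ip_add[OF scale_mem[OF f] scale_mem[OF g] that] ip_scale[OF f that] ip_scale[OF g that]) simp
  have gf: "ip g f = cnj b" unfolding b_def by (rule ip_cnj[OF g f])
  have wg: "ip g w = 0"
    using ip_cnj[OF g w] left[OF g] ip_self(1)[OF g] by (simp add: a_def b_def)
  have wf: "ip f w = of_real (a * sqnorm ip f - (cmod b)\<^sup>2)"
    using ip_cnj[OF f w] left[OF f] ip_self(1)[OF f] gf
    by (simp add: complex_mult_cnj cmod_power2 mult.commute) 
  have "ip w w = of_real (a * (a * sqnorm ip f - (cmod b)\<^sup>2))"
    using left[OF w] wg wf by simp
  then have "0 \<le> a * (a * sqnorm ip f - (cmod b)\<^sup>2)"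
    using ip_self(2)[OF w] by (simp add: sqnorm_def)
  then have "0 \<le> a * sqnorm ip f - (cmod b)\<^sup>2"
    using a by (simp add: zero_le_mult_iff)
  then show ?thesis by (simp add: a_def b_def mult.commute)
qed

lemma kernel_cnj:
  assumes "z \<in> \<Omega>" "w \<in> \<Omega>"
  shows "K z w = cnj (K w z)"
proof -
  have "ip (restrict0 \<Omega> (\<lambda>u. K u w)) (restrict0 \<Omega> (\<lambda>u. K u z)) = K z w"
    using reproducing[OF kernel_mem] assms by (simp add: restrict0_def)
  moreover have "ip (restrict0 \<Omega> (\<lambda>u. K u z)) (restrict0 \<Omega> (\<lambda>u. K u w)) = K w z"
    using reproducing[OF kernel_mem] assms by (simp add: restrict0_def)
  ultimately show ?thesis using ip_cnj kernel_mem assms by metis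
qed

lemma kernel_combination:
  assumes "finite X" "X \<subseteq> \<Omega>"
  shows "restrict0 \<Omega> (\<lambda>z. \<Sum>x\<in>X. c x * K z x) \<in> H"
    and "g \<in> H \<Longrightarrow> ip g (restrict0 \<Omega> (\<lambda>z. \<Sum>x\<in>X. c x * K z x)) = (\<Sum>x\<in>X. cnj (c x) * g x)"
proof -
  have "restrict0 \<Omega> (\<lambda>z. \<Sum>x\<in>X. c x * K z x) \<in> H \<and>
    (\<forall>g\<in>H. ip g (restrict0 \<Omega> (\<lambda>z. \<Sum>x\<in>X. c x * K z x)) = (\<Sum>x\<in>X. cnj (c x) * g x))"
    using assms
  proof (induction X rule: finite_induct)
    case empty
    then show ?case using zero_mem ip_zero_right by (simp add: restrict0_def)
  next
    case (insert x X)
    have eq: "restrict0 \<Omega> (\<lambda>z. \<Sum>x\<in>insert x X. c x * K z x) =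
        (\<lambda>z. c x * restrict0 \<Omega> (\<lambda>z. K z x) z + restrict0 \<Omega> (\<lambda>z. \<Sum>x\<in>X. c x * K z x) z)"
      using insert.hyps by (auto simp: restrict0_def)
    have x: "x \<in> \<Omega>" and X: "X \<subseteq> \<Omega>" using insert.prems by auto
    note IH = insert.IH[OF X]
    show ?case unfolding eq
      using IH kernel_mem[OF x] insert.hyps reproducing[OF _ x]
      by (simp add: add_mem scale_mem ip_add_right ip_scale_right)
  qed
  then show "restrict0 \<Omega> (\<lambda>z. \<Sum>x\<in>X. c x * K z x) \<in> H"
    and "g \<in> H \<Longrightarrow> ip g (restrict0 \<Omega> (\<lambda>z. \<Sum>x\<in>X. c x * K z x)) = (\<Sum>x\<in>X. cnj (c x) * g x)"
    by auto
qed

text \<open>Multiplication by \<open>\<theta>\<close> is a contraction of the subspace of functions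
  vanishing at \<open>l\<close>, so its adjoint is one too, and that adjoint scales the kernel
  function of the subspace at \<open>x\<close> by \<open>cnj (\<theta> x)\<close>. Cauchy-Schwarz
  replaces the construction of the adjoint.\<close>

lemma multiplier_pos_semidef:
  assumes mem: "\<And>f. f \<in> H \<Longrightarrow> restrict0 \<Omega> (\<lambda>x. \<theta> x * f x) \<in> H"
    and contr: "\<And>f. f \<in> H \<Longrightarrow> sqnorm ip (restrict0 \<Omega> (\<lambda>x. \<theta> x * f x)) \<le> sqnorm ip f"
    and X: "finite X" "X \<subseteq> \<Omega>" and l: "l \<in> \<Omega>" and ll: "K l l \<noteq> 0"
  shows "pos_semidef X (\<lambda>x y. (1 - \<theta> x * cnj (\<theta> y)) * (K x y - K x l * K l y / K l l))"
  unfolding pos_semidef_def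
proof
  fix c :: "'a \<Rightarrow> complex"
  define k where "k = (\<lambda>x y. K x y - K x l * K l y / K l l)"
  \<comment> \<open>\<open>G d\<close> is the combination with coefficients \<open>d\<close> of the
    kernel functions of the subspace, that is, the projection of
    \<open>\<Sum>x\<in>X. d x * K z x\<close> onto the functions vanishing at
    \<open>l\<close>.\<close>
  define G where "G = (\<lambda>d z. restrict0 \<Omega> (\<lambda>z. \<Sum>x\<in>X. d x * K z x) z +
    (- (\<Sum>x\<in>X. d x * K l x) / K l l) * restrict0 \<Omega> (\<lambda>z. K z l) z)"
  have G_mem: "G d \<in> H" for d
    unfolding G_def by (intro add_mem scale_mem kernel_combination kernel_mem X l)
  have G_eq: "G d z = (\<Sum>y\<in>X. k z y * d y)" if "z \<in> \<Omega>" for d z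
    using that unfolding G_def restrict0_def k_def
    by (simp add: algebra_simps sum_subtractf sum_distrib_left sum_divide_distrib)
  have G_l: "G d l = 0" for d
    using G_eq[OF l] ll by (simp add: k_def)
  have ip_G: "ip g (G d) = (\<Sum>x\<in>X. cnj (d x) * g x)" if "g \<in> H" "g l = 0" for g d
    unfolding G_def using that kernel_combination[OF X] kernel_mem[OF l] reproducing[OF _ l]
    by (subst ip_add_right) (auto simp only: scale_mem ip_scale_right mult_zero_right add_0_right)
  \<comment> \<open>With these coefficients \<open>v\<close> is the adjoint of multiplication by
    \<open>\<theta>\<close> on the subspace, applied to \<open>u\<close>. The only trace of this
    that is used is \<open>ip p u = ip v v\<close>, which relies on \<open>p\<close> vanishing at
    \<open>l\<close>.\<close>
  define d where "d = (\<lambda>x. c x * cnj (\<theta> x))"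
  define u where "u = G c"
  define v where "v = G d"
  define p where "p = restrict0 \<Omega> (\<lambda>x. \<theta> x * v x)"
  have uv: "u \<in> H" "v \<in> H" unfolding u_def v_def by (rule G_mem)+
  have p: "p \<in> H" "sqnorm ip p \<le> sqnorm ip v" unfolding p_def using mem contr uv by auto
  have "p l = 0" unfolding p_def v_def using l G_l by (simp add: restrict0_def)
  then have "ip p u = (\<Sum>x\<in>X. cnj (c x) * p x)" unfolding u_def using p ip_G by blast
  also have "\<dots> = (\<Sum>x\<in>X. cnj (d x) * v x)"
    unfolding p_def d_def using X by (intro sum.cong) (auto simp: restrict0_def)
  also have "\<dots> = ip v v"
    using ip_G[of v d] uv G_l by (simp add: v_def)
  finally have pu: "ip p u = of_real (sqnorm ip v)" using ip_self(1)[OF uv(2)] by simp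
  have "(sqnorm ip v)\<^sup>2 \<le> sqnorm ip p * sqnorm ip u"
    using Cauchy_Schwarz[OF p(1) uv(1)] pu by simp
  also have "\<dots> \<le> sqnorm ip v * sqnorm ip u"
    using p(2) ip_self(2)[OF uv(1)] by (rule mult_right_mono)
  finally have "sqnorm ip v * sqnorm ip v \<le> sqnorm ip v * sqnorm ip u"
    by (simp add: power2_eq_square)
  then have le: "sqnorm ip v \<le> sqnorm ip u"
    using ip_self(2)[OF uv(2)] ip_self(2)[OF uv(1)]
    by (cases "sqnorm ip v = 0") (auto simp: mult_le_cancel_left)
  have ip_GG: "ip (G e) (G e) = (\<Sum>x\<in>X. \<Sum>y\<in>X. cnj (e x) * k x y * e y)" for e
  proof -
    have "ip (G e) (G e) = (\<Sum>x\<in>X. cnj (e x) * G e x)"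
      using ip_G G_mem G_l by blast
    also have "\<dots> = (\<Sum>x\<in>X. \<Sum>y\<in>X. cnj (e x) * k x y * e y)"
      using X by (intro sum.cong refl) (auto simp: G_eq sum_distrib_left mult.assoc subset_iff)
    finally show ?thesis .
  qed
  have "(\<Sum>x\<in>X. \<Sum>y\<in>X. cnj (c x) * ((1 - \<theta> x * cnj (\<theta> y)) * k x y) * c y) = ip u u - ip v v"
    unfolding u_def v_def ip_GG d_def
    by (simp add: algebra_simps sum_subtractf)
  also have "\<dots> = of_real (sqnorm ip u - sqnorm ip v)"
    using ip_self(1) uv by simp
  also have "\<dots> \<in> \<real>\<^sub>\<ge>\<^sub>0" using le by (simp only: nonneg_Reals_of_real_iff)
  finally show "(\<Sum>x\<in>X. \<Sum>y\<in>X. cnj (c x) * ((1 - \<theta> x * cnj (\<theta> y)) *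
      (K x y - K x l * K l y / K l l)) * c y) \<in> \<real>\<^sub>\<ge>\<^sub>0"
    unfolding k_def by simp
qed

section \<open>Two-point interpolation\<close>

text \<open>The extremal multiplier satisfies \<open>1 - \<theta> z * cnj (\<theta> w) = K z x * K x
  w / (K x x * K z w)\<close> at the nodes. Inserting this in \<open>multiplier_pos_semidef\<close>
  gives the claimed matrix up to a diagonal congruence and the positive factor
  \<open>K x x\<close>.\<close>

lemma two_point_CNP_condition:
  assumes NP: "matrix_NP_property \<Omega> K H ip"
    and xy: "x \<in> \<Omega>" "y \<in> \<Omega>" "x \<noteq> y" and l: "l \<in> \<Omega>"
    and nz: "\<And>z w. z \<in> \<Omega> \<Longrightarrow> w \<in> \<Omega> \<Longrightarrow> K z w \<noteq> 0"
  shows "pos_semidef {x, y} (\<lambda>z w. 1 - K z l * K l w / (K l l * K z w))"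
proof -
  define f where "f = (\<lambda>w. restrict0 \<Omega> (\<lambda>z. K z w))"
  have ip_f: "ip (f z) (f w) = K w z" if "z \<in> \<Omega>" "w \<in> \<Omega>" for z w
    using that reproducing[OF kernel_mem] unfolding f_def by (simp add: restrict0_def)
  define N where "N = (\<lambda>z. sqnorm ip (f z))"
  have N: "K z z = of_real (N z)" "N z > 0" if "z \<in> \<Omega>" for z
  proof -
    have fz: "f z \<in> H" unfolding f_def using kernel_mem that by blast
    show "K z z = of_real (N z)" using ip_f[OF that that] ip_self(1)[OF fz] by (simp add: N_def)
    then show "N z > 0" using nz[OF that that] ip_self(2)[OF fz] by (simp add: N_def less_le)
  qed
  \<comment> \<open>The largest value at \<open>y\<close> that keeps the Pick matrix for the targets
    0 and \<open>s\<close> positive semi-definite: its determinant vanishes. Cauchy-Schwarz makes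
    the radicand nonnegative.\<close>
  define s where "s = sqrt (1 - (cmod (K x y))\<^sup>2 / (N x * N y))"
  have "(cmod (K x y))\<^sup>2 \<le> N y * N x"
    using Cauchy_Schwarz[of "f y" "f x"] xy ip_f kernel_mem unfolding N_def f_def by simp
  then have s2: "s\<^sup>2 = 1 - (cmod (K x y))\<^sup>2 / (N x * N y)"
    unfolding s_def using N(2) xy by (simp add: field_simps)
  define t where "t = (\<lambda>z. if z = y then complex_of_real s else 0)"
  define W where "W = (\<lambda>z. Matrix.mat 1 1 (\<lambda>_. t z))"
  have yx: "K y x = cnj (K x y)" using kernel_cnj xy by blast
  have key: "1 - t z * cnj (t w) = K z x * K x w / (K x x * K z w)" if "z \<in> {x, y}" "w \<in> {x, y}" for z w
  proof -
    have "1 - complex_of_real s * complex_of_real s = of_real (1 - s\<^sup>2)"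
      by (simp add: power2_eq_square)
    also have "\<dots> = K y x * K x y / (K x x * K y y)"
      unfolding s2 yx using N(1) xy by (simp add: mult.commute flip: complex_norm_square)
    finally show ?thesis
      using that xy nz unfolding t_def by auto
  qed
  have W1: "(1\<^sub>m 1 - W z * mat_adjoint (W w)) $$ (0, 0) = 1 - t z * cnj (t w)" for z w
    unfolding W_def by (simp add: scalar_prod_def mat_adjoint_def mat_of_rows_def)
  have nodes: "{x, y} \<times> {..<1::nat} = {(x, 0), (y, 0)}" by auto
  have psd: "pos_semidef ({x, y} \<times> {..<1})
    (\<lambda>(z, a) (w, b). (1\<^sub>m 1 - W z * mat_adjoint (W w)) $$ (a, b) * K z w)"
    unfolding pos_semidef_def
  proof
    fix c :: "'a \<times> nat \<Rightarrow> complex"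
    \<comment> \<open>The Pick matrix has rank one, so its quadratic form is the squared modulus of
      \<open>q\<close> divided by \<open>K x x\<close>.\<close>
    define q where "q = (\<Sum>w\<in>{x, y}. K x w * c (w, 0))"
    have cnj_q: "cnj q = (\<Sum>z\<in>{x, y}. cnj (c (z, 0)) * K z x)"
    proof -
      have "cnj (K x w) = K w x" if "w \<in> {x, y}" for w
        using that xy kernel_cnj[of w x] by auto
      then show ?thesis
        unfolding q_def cnj_sum by (intro sum.cong refl) (simp only: complex_cnj_mult mult.commute)
    qed
    have "(\<Sum>i\<in>{x, y} \<times> {..<1}. \<Sum>j\<in>{x, y} \<times> {..<1}. cnj (c i) *
        (case i of (z, a) \<Rightarrow> \<lambda>(w, b). (1\<^sub>m 1 - W z * mat_adjoint (W w)) $$ (a, b) * K z w) j * c j)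
      = (\<Sum>z\<in>{x, y}. \<Sum>w\<in>{x, y}. cnj (c (z, 0)) * ((1 - t z * cnj (t w)) * K z w) * c (w, 0))"
      using xy(3) by (simp only: nodes sum.insert sum.empty finite.intros insert_iff empty_iff
          prod.inject simp_thms case_prod_conv W1)
    also have "\<dots> = (\<Sum>z\<in>{x, y}. \<Sum>w\<in>{x, y}. cnj (c (z, 0)) * (K z x * K x w / K x x) * c (w, 0))"
      using key nz xy by (intro sum.cong refl) auto
    also have "\<dots> = cnj q * q / K x x"
      unfolding cnj_q by (simp only: q_def sum_product sum_divide_distrib) (simp add: mult_ac)
    also have "\<dots> = of_real ((cmod q)\<^sup>2 / N x)"
      using N(1)[OF xy(1)] by (simp add: mult.commute flip: complex_norm_square)
    also have "\<dots> \<in> \<real>\<^sub>\<ge>\<^sub>0"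
      using N(2)[OF xy(1)] by (simp only: nonneg_Reals_of_real_iff zero_le_divide_iff) simp
    finally show "(\<Sum>i\<in>{x, y} \<times> {..<1}. \<Sum>j\<in>{x, y} \<times> {..<1}. cnj (c i) *
        (case i of (z, a) \<Rightarrow> \<lambda>(w, b). (1\<^sub>m 1 - W z * mat_adjoint (W w)) $$ (a, b) * K z w) j * c j) \<in> \<real>\<^sub>\<ge>\<^sub>0" .
  qed
  obtain \<Phi> where \<Phi>: "contractive_multiplier \<Omega> H ip 1 1 \<Phi>" "\<forall>z\<in>{x, y}. \<Phi> z = W z"
  proof -
    have "\<exists>\<Phi>. contractive_multiplier \<Omega> H ip 1 1 \<Phi> \<and> (\<forall>z\<in>{x, y}. \<Phi> z = W z)"
      using NP[unfolded matrix_NP_property_def, rule_format, of 1 1 "{x, y}" W] psd xy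
      by (simp add: W_def)
    then show ?thesis using that by blast
  qed
  define \<theta> where "\<theta> = (\<lambda>z. \<Phi> z $$ (0, 0))"
  have \<theta>: "\<theta> z = t z" if "z \<in> {x, y}" for z
    using \<Phi>(2) that unfolding \<theta>_def W_def by auto
  have mult: "restrict0 \<Omega> (\<lambda>z. \<theta> z * g z) \<in> H \<and>
      sqnorm ip (restrict0 \<Omega> (\<lambda>z. \<theta> z * g z)) \<le> sqnorm ip g" if "g \<in> H" for g
    using \<Phi>(1)[unfolded contractive_multiplier_def, THEN conjunct2, THEN spec, of "\<lambda>_. g"] that
    by (simp add: mult_op_def \<theta>_def)
  have psd_l: "pos_semidef {x, y} (\<lambda>z w. (1 - \<theta> z * cnj (\<theta> w)) * (K z w - K z l * K l w / K l l))"
    using mult xy l nz by (intro multiplier_pos_semidef) auto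
  show ?thesis
    unfolding pos_semidef_def
  proof
    fix c :: "'a \<Rightarrow> complex"
    \<comment> \<open>The diagonal congruence: the new coefficients absorb the factors
      \<open>K z x\<close> and \<open>K x w\<close>.\<close>
    define d where "d = (\<lambda>z. c z / K x z)"
    have "(\<Sum>z\<in>{x, y}. \<Sum>w\<in>{x, y}. cnj (c z) * (1 - K z l * K l w / (K l l * K z w)) * c w) =
      K x x * (\<Sum>z\<in>{x, y}. \<Sum>w\<in>{x, y}. cnj (d z) *
        ((1 - \<theta> z * cnj (\<theta> w)) * (K z w - K z l * K l w / K l l)) * d w)"
      unfolding sum_distrib_left
    proof (intro sum.cong refl)
      fix z w assume zw: "z \<in> {x, y}" "w \<in> {x, y}"
      then have O: "z \<in> \<Omega>" "w \<in> \<Omega>" using xy by auto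
      have k: "1 - \<theta> z * cnj (\<theta> w) = K z x * K x w / (K x x * K z w)"
        using key[OF zw] \<theta> zw by simp
      have cd: "cnj (d z) = cnj (c z) / K z x"
        unfolding d_def using kernel_cnj[OF O(1) xy(1)] by simp
      show "cnj (c z) * (1 - K z l * K l w / (K l l * K z w)) * c w =
        K x x * (cnj (d z) * ((1 - \<theta> z * cnj (\<theta> w)) * (K z w - K z l * K l w / K l l)) * d w)"
        unfolding k cd using nz O xy l by (simp add: d_def field_simps)
    qed
    also have "\<dots> \<in> \<real>\<^sub>\<ge>\<^sub>0"
      using psd_l N[OF xy(1)] unfolding pos_semidef_def by (intro nonneg_Reals_mult_I) auto
    finally show "(\<Sum>z\<in>{x, y}. \<Sum>w\<in>{x, y}. cnj (c z) * (1 - K z l * K l w / (K l l * K z w)) * c w) \<in> \<real>\<^sub>\<ge>\<^sub>0" .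
  qed
qed

end

section \<open>Binomial asymptotics at 0\<close>

text \<open>The expression is the upper bound of \<open>symmetric_pair_bound\<close> with the powers
  inserted. The constant and linear terms in \<open>t\<close> cancel, and the quadratic coefficient
  is four times the extremal value \<open>- (\<beta> - 1) * (\<beta> - 2) / 2\<close>.\<close>

lemma eventually_binomial_gap_neg:
  fixes \<beta> :: real
  assumes "\<beta> \<ge> 3"
  shows "\<forall>\<^sub>F t in at_right 0. 4 - 2 * ((1 - t) powr \<beta> + (1 + t) powr \<beta>)
     + 2 * ((1 + t) powr \<beta> - (1 - t) powr \<beta>) * t
     - 2 * ((1 - t) powr \<beta> + (1 + t) powr \<beta>) * t\<^sup>2 + 4 * (1 + t) powr \<beta> * t ^ 3 < 0"
    (is "\<forall>\<^sub>F t in _. ?f t < 0")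
proof -
  have "((\<lambda>t. ?f t / t\<^sup>2) \<longlongrightarrow> - 2 * (\<beta> - 1) * (\<beta> - 2)) (at_right 0)"
    by (real_asymp simp: algebra_simps)
  moreover have "- 2 * (\<beta> - 1) * (\<beta> - 2) < 0"
    using assms by (simp add: mult_less_0_iff)
  ultimately have "\<forall>\<^sub>F t in at_right 0. ?f t / t\<^sup>2 < 0"
    by (rule order_tendstoD)
  then show ?thesis
    by eventually_elim (auto simp: divide_less_0_iff)
qed

text \<open>To first order the difference of the powers is \<open>2 * \<beta> * t\<close> and the
  subtracted term is \<open>4 * t\<close>. This supplies the monotonicity hypothesis of
  \<open>symmetric_pair_bound\<close>.\<close>

lemma eventually_binomial_difference_ge:
  fixes \<beta> :: real
  assumes "\<beta> \<ge> 3"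
  shows "\<forall>\<^sub>F t in at_right 0.
    (1 + t) powr \<beta> - (1 - t) powr \<beta> - 2 * ((1 - t) powr \<beta> + (1 + t) powr \<beta>) * t > 0"
    (is "\<forall>\<^sub>F t in _. ?f t > 0")
proof -
  have "((\<lambda>t. ?f t / t) \<longlongrightarrow> 2 * \<beta> - 4) (at_right 0)"
    by (real_asymp simp: algebra_simps)
  moreover have "0 < 2 * \<beta> - 4"
    using assms by simp
  ultimately have "\<forall>\<^sub>F t in at_right 0. 0 < ?f t / t"
    by (rule order_tendstoD)
  then show ?thesis
    using eventually_at_right_less[of "0::real"]
    by eventually_elim (auto simp: zero_less_divide_iff)
qed

section \<open>Estimate of the sum over a symmetric pair\<close>

text \<open>Geometric series cut after the square; the remainder is \<open>w ^ 3 / (1 - w)\<close>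
  with \<open>cmod (1 - w) \<ge> 1 / 2\<close>.\<close>

lemma Re_inverse_one_minus_ge:
  assumes "cmod w \<le> 1 / 2"
  shows "Re (1 / (1 - w)) \<ge> 1 + Re w + Re (w\<^sup>2) - 2 * cmod w ^ 3"
proof -
  have ge: "cmod (1 - w) \<ge> 1 / 2"
    using norm_triangle_ineq2[of 1 w] assms by simp
  then have "1 - w \<noteq> 0" by auto
  then have "1 / (1 - w) = 1 + w + w\<^sup>2 + w ^ 3 / (1 - w)"
    by (simp add: field_simps power2_eq_square power3_eq_cube)
  then have "Re (1 / (1 - w)) = 1 + Re w + Re (w\<^sup>2) + Re (w ^ 3 / (1 - w))"
    by (metis plus_complex.sel(1) one_complex.sel(1))
  moreover have "cmod (w ^ 3 / (1 - w)) \<le> 2 * cmod w ^ 3"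
  proof -
    have "cmod w ^ 3 / cmod (1 - w) \<le> cmod w ^ 3 / (1 / 2)"
      using ge by (intro divide_left_mono) auto
    then show ?thesis by (simp add: norm_divide norm_power)
  qed
  moreover have "- Re (w ^ 3 / (1 - w)) \<le> cmod (w ^ 3 / (1 - w))"
    using abs_Re_le_cmod[of "w ^ 3 / (1 - w)"] by linarith
  ultimately show ?thesis by linarith
qed

lemma inverse_one_minus_ge:
  fixes x :: real
  assumes "x < 1" "0 \<le> x"
  shows "1 / (1 - x) \<ge> 1 + x + x\<^sup>2"
proof -
  have "(1 + x + x\<^sup>2) * (1 - x) = 1 - x ^ 3"
    by (simp add: algebra_simps power2_eq_square power3_eq_cube)
  also have "\<dots> \<le> 1" using assms by simp
  finally show ?thesis using assms by (simp add: pos_le_divide_eq)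
qed

text \<open>Here \<open>p\<close> and \<open>q\<close> stand for the values of \<psi> at
  \<open>h\<close> and \<open>-h\<close>, with \<open>t = h * h\<close>. Splitting into odd and even
  parts, the even part can be discarded from the upper bound. What remains besides the cubic error
  is quadratic in the squared modulus \<open>x\<close> of the odd part and is largest at
  \<open>x = t\<close>.\<close>

lemma symmetric_pair_bound:
  fixes p q :: complex
  assumes AB: "A \<ge> 0" "B \<ge> 0" "B - A \<ge> 2 * (A + B) * t" and t: "0 < t" "t \<le> 1 / 6"
    and p: "(cmod p)\<^sup>2 \<le> t" and q: "(cmod q)\<^sup>2 \<le> t" and pq: "(cmod ((p - q) / 2))\<^sup>2 \<le> t"
  shows "4 - A * (1 / (1 - (cmod p)\<^sup>2) + 1 / (1 - (cmod q)\<^sup>2)) - 2 * B * Re (1 / (1 - p * cnj q))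
    \<le> 4 - 2 * (A + B) + 2 * (B - A) * t - 2 * (A + B) * t\<^sup>2 + 4 * B * t ^ 3"
proof -
  \<comment> \<open>Squared moduli of the odd part (\<open>x\<close>) and the even part
    (\<open>E\<close>); \<open>P + Q = 2 * (x + E)\<close> is the parallelogram law.\<close>
  define x where "x = (cmod ((p - q) / 2))\<^sup>2"
  define E where "E = (cmod ((p + q) / 2))\<^sup>2"
  define P where "P = (cmod p)\<^sup>2"
  define Q where "Q = (cmod q)\<^sup>2"
  define w where "w = p * cnj q"
  have x: "0 \<le> x" "x \<le> t" and E: "0 \<le> E" using pq by (auto simp: x_def E_def)
  have PQ: "P + Q = 2 * (x + E)" "Re w = E - x"
    unfolding P_def Q_def x_def E_def w_def cmod_power2
    by (simp_all add: power2_eq_square field_simps)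
  have PQ_sq: "(P + Q)\<^sup>2 = 4 * (x + E)\<^sup>2"
    unfolding PQ by (simp only: power_mult_distrib) simp
  have P: "0 \<le> P" "P \<le> t" and Q: "0 \<le> Q" "Q \<le> t" using p q by (auto simp: P_def Q_def)
  have PQ2: "P\<^sup>2 + Q\<^sup>2 \<ge> 2 * (x + E)\<^sup>2"
  proof -
    have "2 * (P\<^sup>2 + Q\<^sup>2) - (P + Q)\<^sup>2 = (P - Q)\<^sup>2" by (simp add: power2_eq_square algebra_simps)
    then have "2 * (P\<^sup>2 + Q\<^sup>2) \<ge> (P + Q)\<^sup>2" using zero_le_power2[of "P - Q"] by linarith
    then show ?thesis unfolding PQ_sq by simp
  qed
  have w_norm: "(cmod w)\<^sup>2 = P * Q"
    unfolding w_def P_def Q_def by (simp add: norm_mult power_mult_distrib)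
  also have "\<dots> \<le> t * t" using P Q by (intro mult_mono) auto
  finally have w_t: "cmod w \<le> t"
    using t by (simp add: power2_eq_square[symmetric] power_mono_iff)
  have "(P + Q)\<^sup>2 - 4 * (P * Q) = (P - Q)\<^sup>2" by (simp add: power2_eq_square algebra_simps)
  then have "4 * (P * Q) \<le> (P + Q)\<^sup>2" using zero_le_power2[of "P - Q"] by linarith
  then have w_norm_le: "(cmod w)\<^sup>2 \<le> (x + E)\<^sup>2"
    unfolding w_norm PQ_sq by simp
  have "Re (w\<^sup>2) = 2 * (Re w)\<^sup>2 - (cmod w)\<^sup>2"
    unfolding cmod_power2 by (simp add: power2_eq_square)
  then have "Re (w\<^sup>2) \<ge> 2 * (E - x)\<^sup>2 - (x + E)\<^sup>2"
    using w_norm_le PQ(2) by simp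
  moreover have "2 * (E - x)\<^sup>2 - (x + E)\<^sup>2 = x\<^sup>2 - 6 * (x * E) + E\<^sup>2"
    by (simp add: power2_eq_square algebra_simps)
  ultimately have w2: "Re (w\<^sup>2) \<ge> x\<^sup>2 - 6 * (x * E)"
    using zero_le_power2[of E] by linarith
  have "cmod w ^ 3 \<le> t ^ 3" using w_t by (intro power_mono) auto
  \<comment> \<open>The bound is left unsimplified: \<open>+ E\<close> comes from
    \<open>Re w\<close>, while \<open>- E\<close> bounds the cross term
    \<open>- 6 * (x * E)\<close>, using \<open>x \<le> t \<le> 1 / 6\<close>.\<close>
  then have Re_ge: "Re (1 / (1 - w)) \<ge> 1 + E - x + x\<^sup>2 - E - 2 * t ^ 3"
  proof -
    have "6 * (x * E) \<le> E" using mult_right_mono[of x "1/6" E] x t E by simp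
    moreover have "Re (1 / (1 - w)) \<ge> 1 + Re w + Re (w\<^sup>2) - 2 * cmod w ^ 3"
      using w_t t by (intro Re_inverse_one_minus_ge) simp
    ultimately show ?thesis using w2 PQ(2) \<open>cmod w ^ 3 \<le> t ^ 3\<close> by linarith
  qed
  have "1 / (1 - P) + 1 / (1 - Q) \<ge> 2 + (P + Q) + (P\<^sup>2 + Q\<^sup>2)"
    using inverse_one_minus_ge[of P] inverse_one_minus_ge[of Q] P Q t by linarith
  moreover have "2 + (P + Q) + (P\<^sup>2 + Q\<^sup>2) \<ge> 2 + 2 * (x + E) + 2 * (x + E)\<^sup>2"
    using PQ2 PQ(1) by (simp only: add_mono order_refl)
  moreover have "2 + 2 * (x + E) + 2 * (x + E)\<^sup>2 \<ge> 2 + 2 * x + 2 * x\<^sup>2"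
    using x E by (intro add_mono mult_left_mono power_mono) auto
  ultimately have "1 / (1 - P) + 1 / (1 - Q) \<ge> 2 + 2 * x + 2 * x\<^sup>2"
    by (meson order_trans)
  then have "A * (1 / (1 - P) + 1 / (1 - Q)) \<ge> A * (2 + 2 * x + 2 * x\<^sup>2)"
    using AB(1) by (intro mult_left_mono)
  moreover have "2 * B * Re (1 / (1 - w)) \<ge> 2 * B * (1 + E - x + x\<^sup>2 - E - 2 * t ^ 3)"
    using AB(2) Re_ge by (intro mult_left_mono) auto
  ultimately have "4 - A * (1 / (1 - P) + 1 / (1 - Q)) - 2 * B * Re (1 / (1 - w))
    \<le> 4 - 2 * (A + B) + 2 * (B - A) * x - 2 * (A + B) * x\<^sup>2 + 4 * B * t ^ 3"
    by (simp add: algebra_simps)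
  \<comment> \<open>The right side minus the left side factors as
    \<open>2 * (t - x) * (B - A - (A + B) * (t + x))\<close>, and \<open>t + x \<le> 2 * t\<close>
    brings in the hypothesis on \<open>B - A\<close>.\<close>
  moreover have "2 * (B - A) * x - 2 * (A + B) * x\<^sup>2 \<le> 2 * (B - A) * t - 2 * (A + B) * t\<^sup>2"
  proof -
    have "(A + B) * (t + x) \<le> (A + B) * (2 * t)" using AB x by (intro mult_left_mono) auto
    also have "\<dots> = 2 * (A + B) * t" by simp
    also note AB(3)
    finally have "0 \<le> (t - x) * (2 * (B - A - (A + B) * (t + x)))"
      using x by (intro mult_nonneg_nonneg) auto
    then show ?thesis by (simp add: algebra_simps power2_eq_square)
  qed
  ultimately show ?thesis unfolding P_def Q_def w_def by linarith
qed

section \<open>Self-maps of the disc and the negative test sum\<close>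

lemma one_minus_mult_cnj_nonzero:
  assumes "cmod z < 1" "cmod w < 1"
  shows "1 - z * cnj w \<noteq> 0"
proof
  assume "1 - z * cnj w = 0"
  then have "cmod (z * cnj w) = 1" by simp
  moreover have "cmod z * cmod w < 1 * 1" using assms by (intro mult_strict_mono') auto
  ultimately show False by (simp add: norm_mult)
qed

text \<open>Normalising the Szego kernel at \<open>a\<close> amounts to moving \<open>a\<close> to 0
  by a disc automorphism. This permits replacing \<phi> by a function that vanishes at 0, to which
  the Schwarz lemma applies.\<close>

lemma Moebius_function_kernel:
  assumes "cmod a < 1" "cmod z < 1" "cmod w < 1"
  shows "(1 - z * cnj a) * (1 - a * cnj w) / ((1 - a * cnj a) * (1 - z * cnj w)) =
    1 / (1 - Moebius_function 0 a z * cnj (Moebius_function 0 a w))"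
proof -
  have nz: "1 - a * cnj a \<noteq> 0" "1 - z * cnj w \<noteq> 0" "1 - cnj a * z \<noteq> 0" "1 - a * cnj w \<noteq> 0"
    using one_minus_mult_cnj_nonzero assms by (simp_all add: mult.commute)
  have clear: "(1 - r / u * (s / v)) * (u * v) = u * v - r * s" if "u \<noteq> 0" "v \<noteq> 0" for r s u v :: complex
    using that by (simp add: field_simps)
  have "(1 - Moebius_function 0 a z * cnj (Moebius_function 0 a w)) * ((1 - cnj a * z) * (1 - a * cnj w)) =
      (1 - cnj a * z) * (1 - a * cnj w) - (z - a) * (cnj w - cnj a)"
    using clear[OF nz(3,4)] by (simp add: Moebius_function_simple)
  also have "\<dots> = (1 - a * cnj a) * (1 - z * cnj w)"
    by (simp add: algebra_simps)
  finally have eq: "(1 - a * cnj a) * (1 - z * cnj w) =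
    (1 - Moebius_function 0 a z * cnj (Moebius_function 0 a w)) * ((1 - cnj a * z) * (1 - a * cnj w))" ..
  have "(1 - z * cnj a) * (1 - a * cnj w) = (1 - cnj a * z) * (1 - a * cnj w)"
    by (simp add: mult.commute)
  then show ?thesis
    unfolding eq using nz(3,4) by (simp only: nonzero_divide_mult_cancel_right mult_eq_0_iff simp_thms)
qed

text \<open>Maximum modulus principle. The strict bound keeps the kernel free of zeros and puts
  \<open>\<phi> 0\<close> inside the disc, as the automorphism requires.\<close>

lemma Hinf1_nonconstant_norm_less:
  assumes "\<phi> \<in> Hinf1" "\<not> \<phi> constant_on \<bbbD>" "z \<in> \<bbbD>"
  shows "cmod (\<phi> z) < 1"
proof (rule ccontr)
  assume "\<not> cmod (\<phi> z) < 1"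
  then have "cmod (\<phi> w) \<le> cmod (\<phi> z)" if "w \<in> \<bbbD>" for w
    using assms(1) that unfolding Hinf1_def by fastforce
  moreover have "\<phi> holomorphic_on \<bbbD>" using assms(1) by (simp add: Hinf1_def)
  ultimately have "\<phi> constant_on \<bbbD>"
    using assms(3) by (intro maximum_modulus_principle[of \<phi> \<bbbD> \<bbbD> z]) auto
  then show False using assms(2) by blast
qed

lemma symmetric_pair_sum_neg:
  fixes \<beta> :: real
  assumes \<beta>: "\<beta> \<ge> 3" and hol: "\<psi> holomorphic_on \<bbbD>" and zero: "\<psi> 0 = 0"
    and bd: "\<And>z. cmod z < 1 \<Longrightarrow> cmod (\<psi> z) < 1"
  obtains h :: real where "0 < h" "h < 1"
    "Re (\<Sum>z\<in>{of_real h, - of_real h}. \<Sum>w\<in>{of_real h, - of_real h}.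
      1 - (1 - z * cnj w) powr of_real \<beta> / (1 - \<psi> z * cnj (\<psi> w))) < 0"
proof -
  have "\<forall>\<^sub>F t :: real in at_right 0. t < 1 / 6" by real_asymp
  then have "\<forall>\<^sub>F t in at_right 0. 0 < t \<and> t \<le> 1 / 6 \<and>
    4 - 2 * ((1 - t) powr \<beta> + (1 + t) powr \<beta>)
     + 2 * ((1 + t) powr \<beta> - (1 - t) powr \<beta>) * t
     - 2 * ((1 - t) powr \<beta> + (1 + t) powr \<beta>) * t\<^sup>2 + 4 * (1 + t) powr \<beta> * t ^ 3 < 0 \<and>
    (1 + t) powr \<beta> - (1 - t) powr \<beta> \<ge> 2 * ((1 - t) powr \<beta> + (1 + t) powr \<beta>) * t"
    using eventually_at_right_less[of "0::real"] eventually_binomial_gap_neg[OF \<beta>]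
      eventually_binomial_difference_ge[OF \<beta>]
    by eventually_elim auto
  then obtain t where t: "0 < t" "t \<le> 1 / 6"
    and neg: "4 - 2 * ((1 - t) powr \<beta> + (1 + t) powr \<beta>)
     + 2 * ((1 + t) powr \<beta> - (1 - t) powr \<beta>) * t
     - 2 * ((1 - t) powr \<beta> + (1 + t) powr \<beta>) * t\<^sup>2 + 4 * (1 + t) powr \<beta> * t ^ 3 < 0"
    and diff: "(1 + t) powr \<beta> - (1 - t) powr \<beta> \<ge> 2 * ((1 - t) powr \<beta> + (1 + t) powr \<beta>) * t"
    using eventually_happens'[OF trivial_limit_at_right_real] by blast
  \<comment> \<open>With this choice \<open>z * cnj w\<close> is \<open>t\<close> for equal nodes
    and \<open>-t\<close> for opposite ones.\<close>
  define h where "h = sqrt t"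
  have h: "0 < h" "h < 1" "h * h = t"
    using t by (auto simp: h_def)
  have schwarz: "(cmod (f (of_real h)))\<^sup>2 \<le> t" if "f holomorphic_on \<bbbD>" "f 0 = 0"
    "\<And>z. cmod z < 1 \<Longrightarrow> cmod (f z) < 1" for f
  proof -
    have "cmod (f (of_real h)) \<le> h"
      using Schwarz_Lemma(1)[OF that, of "of_real h"] h by simp
    then have "(cmod (f (of_real h)))\<^sup>2 \<le> h\<^sup>2" by (intro power_mono) auto
    then show ?thesis using h by (simp add: power2_eq_square)
  qed
  define p where "p = \<psi> (of_real h)"
  define q where "q = \<psi> (- of_real h)"
  have "(\<psi> \<circ> uminus) holomorphic_on \<bbbD>"
    by (rule holomorphic_on_compose_gen[OF _ hol]) (auto intro!: holomorphic_on_minus[OF holomorphic_on_ident])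
  then have hol': "(\<lambda>z. \<psi> (- z)) holomorphic_on \<bbbD>" by (simp add: o_def)
  have p: "(cmod p)\<^sup>2 \<le> t" unfolding p_def using schwarz[OF hol zero] bd by simp
  have q: "(cmod q)\<^sup>2 \<le> t" unfolding q_def using schwarz[OF hol'] zero bd by simp
  \<comment> \<open>The Schwarz lemma once more, now for the odd part of \<psi>.\<close>
  have pq: "(cmod ((p - q) / 2))\<^sup>2 \<le> t"
    unfolding p_def q_def
  proof (rule schwarz)
    show "(\<lambda>z. (\<psi> z - \<psi> (- z)) / 2) holomorphic_on \<bbbD>"
      using hol hol' by (intro holomorphic_intros) auto
    show "cmod ((\<psi> z - \<psi> (- z)) / 2) < 1" if "cmod z < 1" for z
      using bd[OF that] bd[of "- z"] that norm_triangle_ineq4[of "\<psi> z" "\<psi> (- z)"]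
      by (simp add: norm_divide)
  qed (simp add: zero)
  define A where "A = (1 - t) powr \<beta>"
  define B where "B = (1 + t) powr \<beta>"
  \<comment> \<open>The bases are the positive reals \<open>1 - t\<close> and \<open>1 + t\<close>,
    where the principal branch is the real power.\<close>
  have powr: "(1 - of_real h * of_real h) powr complex_of_real \<beta> = of_real A"
    "(1 + of_real h * of_real h) powr complex_of_real \<beta> = of_real B"
    using powr_of_real[of "1 - t" \<beta>] powr_of_real[of "1 + t" \<beta>] t h(3)
    unfolding A_def B_def by (simp_all flip: of_real_mult)
  have sq: "Re (1 / (1 - u * cnj u)) = 1 / (1 - (cmod u)\<^sup>2)" for u
  proof -
    have "1 / (1 - u * cnj u) = of_real (1 / (1 - (cmod u)\<^sup>2))"
      by (simp only: complex_norm_square of_real_divide of_real_diff of_real_1)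
    then show ?thesis by (simp only: Re_complex_of_real)
  qed
  have "1 / (1 - q * cnj p) = cnj (1 / (1 - p * cnj q))"
    by (simp add: mult.commute)
  then have conj: "Re (1 / (1 - q * cnj p)) = Re (1 / (1 - p * cnj q))"
    by (simp only: cnj.simps)
  define F where "F = (\<lambda>z w. 1 - (1 - z * cnj w) powr of_real \<beta> / (1 - \<psi> z * cnj (\<psi> w)))"
  have F: "F (of_real h) (of_real h) = 1 - of_real A * (1 / (1 - p * cnj p))"
    "F (of_real h) (- of_real h) = 1 - of_real B * (1 / (1 - p * cnj q))"
    "F (- of_real h) (of_real h) = 1 - of_real B * (1 / (1 - q * cnj p))"
    "F (- of_real h) (- of_real h) = 1 - of_real A * (1 / (1 - q * cnj q))"
    unfolding F_def p_def q_def by (simp_all add: powr)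
  have Re_1: "Re (1 - of_real c * u) = 1 - c * Re u" for c u by simp
  have "complex_of_real h \<noteq> - of_real h" using h(1) by simp
  then have "(\<Sum>z\<in>{of_real h, - of_real h}. \<Sum>w\<in>{of_real h, - of_real h}. F z w) =
      (F (of_real h) (of_real h) + F (of_real h) (- of_real h)) +
      (F (- of_real h) (of_real h) + F (- of_real h) (- of_real h))"
    by simp
  then have "Re (\<Sum>z\<in>{of_real h, - of_real h}. \<Sum>w\<in>{of_real h, - of_real h}. F z w) =
    4 - A * (1 / (1 - (cmod p)\<^sup>2) + 1 / (1 - (cmod q)\<^sup>2)) - 2 * B * Re (1 / (1 - p * cnj q))"
    by (simp only: plus_complex.sel F Re_1 sq conj) (simp add: algebra_simps)
  also have "\<dots> \<le> 4 - 2 * (A + B) + 2 * (B - A) * t - 2 * (A + B) * t\<^sup>2 + 4 * B * t ^ 3"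
    using diff t p q pq by (intro symmetric_pair_bound) (auto simp: A_def B_def)
  also have "\<dots> < 0" using neg by (simp add: A_def B_def)
  finally show thesis using that[OF h(1,2)] unfolding F_def by blast
qed

text \<open>The Bergman kernel equals 1 when either argument is 0, so its normalisation at 0 only
  leaves the reciprocal of the kernel. The factor with \<phi> is handled by
  \<open>Moebius_function_kernel\<close> at \<open>a = \<phi> 0\<close>.\<close>

lemma sub_bergman_kernel_normalized:
  assumes "\<And>z. z \<in> \<bbbD> \<Longrightarrow> cmod (\<phi> z) < 1" "z \<in> \<bbbD>" "w \<in> \<bbbD>"
  shows "sub_bergman_kernel \<alpha> \<phi> z 0 * sub_bergman_kernel \<alpha> \<phi> 0 w /
      (sub_bergman_kernel \<alpha> \<phi> 0 0 * sub_bergman_kernel \<alpha> \<phi> z w) =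
    (1 - z * cnj w) powr of_real (2 + \<alpha>) /
      (1 - Moebius_function 0 (\<phi> 0) (\<phi> z) * cnj (Moebius_function 0 (\<phi> 0) (\<phi> w)))"
proof -
  define a where "a = \<phi> 0"
  define b where "b = (1 - z * cnj w) powr complex_of_real (2 + \<alpha>)"
  have "sub_bergman_kernel \<alpha> \<phi> z 0 * sub_bergman_kernel \<alpha> \<phi> 0 w /
      (sub_bergman_kernel \<alpha> \<phi> 0 0 * sub_bergman_kernel \<alpha> \<phi> z w) =
    b * ((1 - \<phi> z * cnj a) * (1 - a * cnj (\<phi> w)) / ((1 - a * cnj a) * (1 - \<phi> z * cnj (\<phi> w))))"
    by (simp add: sub_bergman_kernel_def bergman_kernel_def a_def b_def)
  also have "\<dots> = b * (1 / (1 - Moebius_function 0 a (\<phi> z) * cnj (Moebius_function 0 a (\<phi> w))))"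
    using assms by (subst Moebius_function_kernel) (simp_all add: a_def)
  finally show ?thesis by (simp add: a_def b_def)
qed

theorem theorem4p7:
  fixes \<alpha> :: real
  assumes "\<alpha> \<ge> 1"
  shows "\<not> (\<exists>\<phi>\<in>Hinf1. \<not> \<phi> constant_on \<bbbD> \<and> CNP_kernel \<bbbD> (sub_bergman_kernel \<alpha> \<phi>))"
proof
  assume "\<exists>\<phi>\<in>Hinf1. \<not> \<phi> constant_on \<bbbD> \<and> CNP_kernel \<bbbD> (sub_bergman_kernel \<alpha> \<phi>)"
  then obtain \<phi> H ip where \<phi>: "\<phi> \<in> Hinf1" "\<not> \<phi> constant_on \<bbbD>"
    and H: "rkhs \<bbbD> (sub_bergman_kernel \<alpha> \<phi>) H ip"
    and NP: "matrix_NP_property \<bbbD> (sub_bergman_kernel \<alpha> \<phi>) H ip"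
    unfolding CNP_kernel_def by blast
  have lt1: "cmod (\<phi> z) < 1" if "z \<in> \<bbbD>" for z
    using Hinf1_nonconstant_norm_less[OF \<phi> that] .
  have nz: "sub_bergman_kernel \<alpha> \<phi> z w \<noteq> 0" if "z \<in> \<bbbD>" "w \<in> \<bbbD>" for z w
    using that one_minus_mult_cnj_nonzero[of "\<phi> z" "\<phi> w"] one_minus_mult_cnj_nonzero[of z w] lt1
    by (simp add: sub_bergman_kernel_def bergman_kernel_def)
  define \<psi> where "\<psi> = (\<lambda>z. Moebius_function 0 (\<phi> 0) (\<phi> z))"
  have "(Moebius_function 0 (\<phi> 0) \<circ> \<phi>) holomorphic_on \<bbbD>"
    using \<phi>(1) lt1 Moebius_function_holomorphic[of "\<phi> 0" 0]
    by (intro holomorphic_on_compose_gen[of _ _ _ \<bbbD>]) (auto simp: Hinf1_def)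
  then have hol: "\<psi> holomorphic_on \<bbbD>"
    by (simp add: \<psi>_def o_def)
  have bd: "cmod (\<psi> z) < 1" if "cmod z < 1" for z
    unfolding \<psi>_def using that lt1 by (intro Moebius_function_norm_lt_1) auto
  have \<beta>: "2 + \<alpha> \<ge> 3" and zero: "\<psi> 0 = 0"
    using assms by (simp_all add: \<psi>_def Moebius_function_eq_zero)
  obtain h :: real where h: "0 < h" "h < 1"
    and neg: "Re (\<Sum>z\<in>{of_real h, - of_real h}. \<Sum>w\<in>{of_real h, - of_real h}.
      1 - (1 - z * cnj w) powr of_real (2 + \<alpha>) / (1 - \<psi> z * cnj (\<psi> w))) < 0"
    by (rule symmetric_pair_sum_neg[OF \<beta> hol zero bd])
  define X where "X = {complex_of_real h, - of_real h}"
  have X: "X \<subseteq> \<bbbD>" unfolding X_def using h by auto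
  have "pos_semidef X (\<lambda>z w. 1 - sub_bergman_kernel \<alpha> \<phi> z 0 * sub_bergman_kernel \<alpha> \<phi> 0 w /
      (sub_bergman_kernel \<alpha> \<phi> 0 0 * sub_bergman_kernel \<alpha> \<phi> z w))"
    unfolding X_def using X h nz by (intro rkhs.two_point_CNP_condition[OF H NP]) (auto simp: X_def)
  \<comment> \<open>All coefficients are taken to be 1, so the quadratic form is the sum of the
    matrix entries, whose real part is negative for the chosen \<open>h\<close>.\<close>
  then have "(\<Sum>z\<in>X. \<Sum>w\<in>X. cnj 1 * (1 - sub_bergman_kernel \<alpha> \<phi> z 0 * sub_bergman_kernel \<alpha> \<phi> 0 w /
      (sub_bergman_kernel \<alpha> \<phi> 0 0 * sub_bergman_kernel \<alpha> \<phi> z w)) * 1) \<in> \<real>\<^sub>\<ge>\<^sub>0"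
    unfolding pos_semidef_def by (rule spec)
  also have "(\<Sum>z\<in>X. \<Sum>w\<in>X. cnj 1 * (1 - sub_bergman_kernel \<alpha> \<phi> z 0 * sub_bergman_kernel \<alpha> \<phi> 0 w /
      (sub_bergman_kernel \<alpha> \<phi> 0 0 * sub_bergman_kernel \<alpha> \<phi> z w)) * 1) =
    (\<Sum>z\<in>X. \<Sum>w\<in>X. 1 - (1 - z * cnj w) powr of_real (2 + \<alpha>) / (1 - \<psi> z * cnj (\<psi> w)))"
    using X sub_bergman_kernel_normalized[OF lt1]
    by (intro sum.cong refl) (auto simp: \<psi>_def subset_iff)
  finally show False
    using neg unfolding X_def by (auto simp: complex_nonneg_Reals_iff)
qed

end
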